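(* Fix any constant deletion rate $0<\delta<1$. Any $\ell$-local SQ algorithm for average-case trace reconstruction of $n$-bit strings must have tolerance $\tau_0 \le O(\ell/\sqrt n)$ (the implied constant depending only on $\delta$).
   Context: Trace reconstruction: fix a deletion rate $\delta\in(0,1)$. For a source string $x=(x_0,\dots,x_{n-1})\in\{0,1\}^n$, a random trace $\mathbf y\sim \mathrm{Del}_\delta(x)$ is obtained by deleting each bit of $x$ independently with probability $\delta$ and concatenating the surviving bits; traces are padded with zeros to length $n$. An SQ oracle for $x$ takes a query function $q:\{0,1\}^n\to[-1,1]$ and a tolerance $\tau\in(0,1)$ and returns some value within $\tau$ of $\mathbb E_{\mathbf y\sim \mathrm{Del}_\delta(x)}[q(\mathbf y)]$. A query $q$ is $\ell$-local if $q(y)=q'(y_i,\dots,y_{i+\ell-1})$ for some index $i$ and some $q':\{0,1\}^\ell\to[-1,1]$. An $\ell$-local SQ algorithm with tolerance $\tau_0$ makes only $\ell$-local queries, each with tolerance at least $\tau_0$ (it may be adaptive). It solves average-case trace reconstruction if it correctly outputs the source string $x$ (for every valid sequence of oracle responses) for all but an $o_n(1)$ fraction of the $2^n$ source strings $x\in\{0,1\}^n$. *)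

theory Defs
  imports "HOL-Probability.Probability" "HOL-Probability.Product_PMF"
begin

definition zero_pad :: "nat \<Rightarrow> bool list \<Rightarrow> bool list" where
  "zero_pad n s = s @ replicate (n - length s) False"

text \<open>The flag \<open>d i\<close> says that the bit at position \<open>i\<close> is deleted.\<close>

definition trace_pmf :: "real \<Rightarrow> bool list \<Rightarrow> bool list pmf" where
  "trace_pmf \<delta> x =
     map_pmf (\<lambda>d. zero_pad (length x) (nths x {i. \<not> d i}))
       (Pi_pmf {..<length x} False (\<lambda>_. bernoulli_pmf \<delta>))"

definition local_query :: "nat \<Rightarrow> nat \<Rightarrow> (bool list \<Rightarrow> real) \<Rightarrow> bool" where
  "local_query n l q \<longleftrightarrow>
     (\<exists>i q'. i + l \<le> n \<and>
             (\<forall>z. length z = l \<longrightarrow> q' z \<in> {-1..1}) \<and>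
             (\<forall>y. length y = n \<longrightarrow> q y = q' (take l (drop i y))))"

datatype sq_action = Query "bool list \<Rightarrow> real" real | Output "bool list"

text \<open>
  A (deterministic, adaptive) algorithm maps the list of oracle responses received so far to its
  next action. It halts at its first \<^const>\<open>Output\<close>; its values on longer histories are irrelevant.
  No termination is built in: an algorithm may query forever on sources where it fails.
\<close>

type_synonym sq_algorithm = "real list \<Rightarrow> sq_action"

definition local_sq_algorithm :: "nat \<Rightarrow> nat \<Rightarrow> real \<Rightarrow> sq_algorithm \<Rightarrow> bool" where
  "local_sq_algorithm n l \<tau>\<^sub>0 A \<longleftrightarrow>
     (\<forall>h q \<tau>. A h = Query q \<tau> \<longrightarrow> local_query n l q \<and> 0 < \<tau> \<and> \<tau> < 1 \<and> \<tau>\<^sub>0 \<le> \<tau>)"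

text \<open>
  \<open>r m\<close> is the response to the \<open>m\<close>-th query. The oracle need not answer a repeated query
  consistently.
\<close>

definition valid_responses :: "real \<Rightarrow> bool list \<Rightarrow> sq_algorithm \<Rightarrow> (nat \<Rightarrow> real) \<Rightarrow> bool" where
  "valid_responses \<delta> x A r \<longleftrightarrow>
     (\<forall>m q \<tau>. A (map r [0..<m]) = Query q \<tau> \<longrightarrow>
        \<bar>r m - measure_pmf.expectation (trace_pmf \<delta> x) q\<bar> \<le> \<tau>)"

definition halts_with :: "sq_algorithm \<Rightarrow> (nat \<Rightarrow> real) \<Rightarrow> bool list \<Rightarrow> bool" where
  "halts_with A r z \<longleftrightarrow>
     (\<exists>m. A (map r [0..<m]) = Output z \<and> (\<forall>j<m. \<forall>w. A (map r [0..<j]) \<noteq> Output w))"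

definition reconstructs :: "real \<Rightarrow> sq_algorithm \<Rightarrow> bool list \<Rightarrow> bool" where
  "reconstructs \<delta> A x \<longleftrightarrow> (\<forall>r. valid_responses \<delta> x A r \<longrightarrow> halts_with A r x)"

definition solves_average_case :: "real \<Rightarrow> (nat \<Rightarrow> sq_algorithm) \<Rightarrow> bool" where
  "solves_average_case \<delta> A \<longleftrightarrow>
     (\<lambda>n. real (card {x. length x = n \<and> \<not> reconstructs \<delta> (A n) x}) / 2 ^ n) \<longlonglongrightarrow> 0"

end

theory Submission
  imports Defs
begin

text \<open>
  Two sources that differ only in their last bit produce traces that differ in at most one
  position, namely the number of surviving bits among the first \<open>n - 1\<close>. That number is binomial, so
  it falls into a given window of length \<open>l\<close> with probability \<open>O(l / sqrt n)\<close>. Hence if the tolerance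
  is larger, the true expectations for one source are valid answers for the other one, and the
  algorithm errs on at least one source of each such pair, that is, on half of all sources.
\<close>

section \<open>Anticoncentration of the binomial distribution\<close>

text \<open>The sum telescopes: by the absorption identities for binomial coefficients, each summand
  is a multiple of a difference of consecutive Bernstein polynomials of degree \<open>m\<close>. A
  point probability thereby becomes a truncated first moment, which the variance controls.\<close>

lemma sum_Bernstein_times_deviation:
  "(\<Sum>k\<le>j. Bernstein (Suc m) k p * (real (Suc m) * p - real k))
     = real (Suc m) * p * (1 - p) * Bernstein m j p"
proof (induction j)
  case 0
  show ?case by (simp add: Bernstein_def)
next
  case (Suc j)
  have "Bernstein (Suc m) (Suc j) p * (real (Suc m) * p - real (Suc j))
          = real (Suc m) * p * (1 - p) * (Bernstein m (Suc j) p - Bernstein m j p)"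
  proof (cases "j \<le> m")
    case True
    then obtain r where r: "m = j + r"
      using le_Suc_ex by blast
    have c1: "real (Suc m choose Suc j) * real (Suc j) = real (Suc m) * real (m choose j)"
      by (metis Suc_times_binomial_eq of_nat_mult)
    have c2: "real (Suc m choose Suc j) * real r = real (Suc m) * real (m choose Suc j)"
    proof -
      have "real (m choose Suc j) = real (Suc m choose Suc j) - real (m choose j)"
        by simp
      then show ?thesis
        using c1 r by (simp add: algebra_simps)
    qed
    \<comment> \<open>With \<open>m = j + r\<close>, the deviation splits into two parts whose
      coefficients \<open>real r\<close> and \<open>real (Suc j)\<close> are absorbed by
      \<open>c2\<close> and \<open>c1\<close>.\<close>
    have e: "real (Suc m) * p - real (Suc j) = real r * p - real (Suc j) * (1 - p)"
      using r by (simp add: algebra_simps)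
    have "Bernstein (Suc m) (Suc j) p * (real (Suc m) * p - real (Suc j))
       = (real (Suc m choose Suc j) * real r) * (p * p ^ Suc j * (1 - p) ^ r)
         - (real (Suc m choose Suc j) * real (Suc j)) * (p ^ Suc j * (1 - p) ^ Suc r)"
      unfolding e using r by (simp add: Bernstein_def algebra_simps)
    also have "\<dots> = real (Suc m) * p * (1 - p) * (Bernstein m (Suc j) p - Bernstein m j p)"
    proof -
      have "real (m choose Suc j) * (p * p ^ Suc j * (1 - p) ^ r)
              = p * (1 - p) * Bernstein m (Suc j) p"
        \<comment> \<open>For \<open>r = 0\<close> both sides vanish; otherwise one factor
          \<open>1 - p\<close> splits off from \<open>(1 - p) ^ r\<close>.\<close>
        using r by (cases r) (simp_all add: Bernstein_def)
      moreover have "real (m choose j) * (p ^ Suc j * (1 - p) ^ Suc r)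
              = p * (1 - p) * Bernstein m j p"
        using r by (simp add: Bernstein_def)
      ultimately show ?thesis
        unfolding c1 c2 mult.assoc by (simp only: right_diff_distrib mult.assoc)
    qed
    finally show ?thesis .
  qed (simp add: Bernstein_def binomial_eq_0)
  with Suc show ?case
    by (simp add: right_diff_distrib)
qed

lemma sum_Bernstein_variance:
  "(\<Sum>k\<le>n. (real k - real n * p)\<^sup>2 * Bernstein n k p) = real n * p * (1 - p)"
proof -
  \<comment> \<open>The square is expanded into factorial moments, the form in which the Bernstein
    sums are known.\<close>
  have *: "(a - b)\<^sup>2 * x = a * (a - 1) * x + (1 - 2 * b) * (a * x) + b * b * x" for a b x :: real
    by (simp add: algebra_simps power2_eq_square)
  show ?thesis
    by (simp only: * sum.distrib sum_distrib_left[symmetric] sum_Bernstein sum_k_Bernstein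
          sum_kk_Bernstein) (simp add: algebra_simps power2_eq_square)
qed

text \<open>With \<open>s\<close> the standard deviation for \<open>Suc m\<close> trials, the
  telescoped identity expresses \<open>s\<^sup>2 * Bernstein m j p\<close> as a truncated first
  moment, and that moment is at most \<open>s\<close>.\<close>

lemma Bernstein_le_inverse_sqrt:
  assumes "0 < p" "p < 1"
  shows "Bernstein m j p \<le> 1 / sqrt (real (Suc m) * p * (1 - p))"
proof (cases "j \<le> m")
  case True
  define s where "s = sqrt (real (Suc m) * p * (1 - p))"
  have s: "s > 0" and s2: "s\<^sup>2 = real (Suc m) * p * (1 - p)"
    using assms by (simp_all add: s_def)
  \<comment> \<open>This trades the first moment for the second one; the weights are chosen so that
    the full sum is s/2 + s/2.\<close>
  have amgm: "t \<le> t\<^sup>2 / (2 * s) + s / 2" for t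
  proof -
    have "0 \<le> (t - s)\<^sup>2" by simp
    then show ?thesis
      using s by (simp add: field_simps power2_eq_square)
  qed
  have nn: "0 \<le> Bernstein (Suc m) k p" for k
    using assms by (simp add: Bernstein_nonneg)
  have "s\<^sup>2 * Bernstein m j p
          = (\<Sum>k\<le>j. Bernstein (Suc m) k p * (real (Suc m) * p - real k))"
    by (simp only: sum_Bernstein_times_deviation s2)
  also have "\<dots> \<le> (\<Sum>k\<le>j. Bernstein (Suc m) k p * ((real k - real (Suc m) * p)\<^sup>2 / (2 * s) + s / 2))"
    using amgm by (intro sum_mono mult_left_mono nn) (metis power2_commute)
  \<comment> \<open>Unlike the signed deviations, the new summands are nonnegative, so the truncated
    sum may be extended to the whole range.\<close>
  also have "\<dots> \<le> (\<Sum>k\<le>Suc m. Bernstein (Suc m) k p * ((real k - real (Suc m) * p)\<^sup>2 / (2 * s) + s / 2))"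
    using True s nn by (intro sum_mono2) auto
  also have "\<dots> = (\<Sum>k\<le>Suc m. (real k - real (Suc m) * p)\<^sup>2 * Bernstein (Suc m) k p) / (2 * s)
                    + (\<Sum>k\<le>Suc m. Bernstein (Suc m) k p) * (s / 2)"
    unfolding sum_divide_distrib sum_distrib_right sum.distrib[symmetric]
    by (intro sum.cong refl) (simp add: distrib_left mult.commute)
  also have "\<dots> = s"
    unfolding sum_Bernstein_variance sum_Bernstein s2[symmetric]
    using s by (simp add: power2_eq_square field_simps)
  finally have "s * (s * Bernstein m j p) \<le> s * 1"
    by (simp add: power2_eq_square mult.assoc)
  then have "Bernstein m j p \<le> 1 / s"
    using s by (simp add: field_simps)
  then show ?thesis
    by (simp only: s_def)
next
  case False
  then show ?thesis
    using assms by (simp add: Bernstein_def binomial_eq_0)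
qed

lemma prob_surviving_count_window:
  assumes "0 < \<delta>" "\<delta> < 1"
  shows "measure_pmf.prob (Pi_pmf {..<Suc m} False (\<lambda>_. bernoulli_pmf \<delta>))
           {d. card {j. j < m \<and> \<not> d j} \<in> {i..<i + l}}
         \<le> real l / sqrt (real (Suc m) * \<delta> * (1 - \<delta>))"
proof -
  let ?P = "Pi_pmf {..<Suc m} False (\<lambda>_. bernoulli_pmf \<delta>)"
  let ?b = "1 / sqrt (real (Suc m) * \<delta> * (1 - \<delta>))"
  let ?g = "\<lambda>d :: nat \<Rightarrow> bool. card {j \<in> {..<m}. d j}"
  \<comment> \<open>\<open>binomial_pmf m \<delta>\<close> counts deletions, so the window of
    survivor counts is reflected. Truncated subtraction may merge values, hence only
    \<open>card T \<le> l\<close>.\<close>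
  define T where "T = (\<lambda>k. m - k) ` {i..<i + l}"
  have T: "finite T" "card T \<le> l"
    using card_image_le[of "{i..<i + l}" "\<lambda>k. m - k"] by (simp_all add: T_def)
  have "binomial_pmf m \<delta> = map_pmf ?g (Pi_pmf {..<m} False (\<lambda>_. bernoulli_pmf \<delta>))"
    using assms by (intro binomial_pmf_altdef') auto
  \<comment> \<open>The flag of the last bit is marginalised out.\<close>
  also have "Pi_pmf {..<m} False (\<lambda>_. bernoulli_pmf \<delta>)
               = map_pmf (\<lambda>d j. if j \<in> {..<m} then d j else False) ?P"
    by (intro Pi_pmf_subset) auto
  also have "map_pmf ?g \<dots> = map_pmf ?g ?P"
    unfolding pmf.map_comp by (intro map_pmf_cong refl) (auto intro!: arg_cong[where f = card])
  finally have bin: "binomial_pmf m \<delta> = map_pmf ?g ?P" .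
  have "{d. card {j. j < m \<and> \<not> d j} \<in> {i..<i + l}} \<subseteq> ?g -` T"
  proof
    fix d :: "nat \<Rightarrow> bool"
    assume "d \<in> {d. card {j. j < m \<and> \<not> d j} \<in> {i..<i + l}}"
    moreover have "card {j. j < m \<and> \<not> d j} + ?g d = m"
    proof -
      have "card {j. j < m \<and> \<not> d j} + ?g d = card ({j. j < m \<and> \<not> d j} \<union> {j \<in> {..<m}. d j})"
        by (subst card_Un_disjoint) auto
      also have "{j. j < m \<and> \<not> d j} \<union> {j \<in> {..<m}. d j} = {..<m}"
        by auto
      finally show ?thesis by simp
    qed
    then have "?g d = m - card {j. j < m \<and> \<not> d j}"
      by linarith
    ultimately show "d \<in> ?g -` T"
      unfolding T_def by blast
  qed
  then have "measure_pmf.prob ?P {d. card {j. j < m \<and> \<not> d j} \<in> {i..<i + l}}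
               \<le> measure_pmf.prob ?P (?g -` T)"
    by (intro measure_pmf.finite_measure_mono) auto
  also have "\<dots> = measure_pmf.prob (binomial_pmf m \<delta>) T"
    by (simp add: bin)
  also have "\<dots> = (\<Sum>k\<in>T. Bernstein m k \<delta>)"
    using assms T by (simp add: measure_measure_pmf_finite Bernstein_def)
  also have "\<dots> \<le> real (card T) * ?b"
    using Bernstein_le_inverse_sqrt[OF assms] by (intro sum_bounded_above)
  also have "\<dots> \<le> real l * ?b"
    using T assms by (intro mult_right_mono) auto
  finally show ?thesis by simp
qed

section \<open>Local queries and the last bit\<close>

lemma expectation_trace_pmf:
  fixes q :: "bool list \<Rightarrow> real"
  shows "measure_pmf.expectation (trace_pmf \<delta> x) q
     = measure_pmf.expectation (Pi_pmf {..<length x} False (\<lambda>_. bernoulli_pmf \<delta>))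
         (\<lambda>d. q (zero_pad (length x) (nths x {i. \<not> d i})))"
  unfolding trace_pmf_def by simp

lemma length_zero_pad_nths: "length (zero_pad (length x) (nths x I)) = length x"
proof -
  have "card {i. i < length x \<and> i \<in> I} \<le> card {..<length x}"
    by (intro card_mono) auto
  then show ?thesis
    by (simp add: zero_pad_def length_nths)
qed

text \<open>A surviving last bit lands right behind the survivors of \<open>xs\<close>, with only
  padding after it; a deleted one leaves no mark.\<close>

lemma zero_pad_nths_snoc_nth:
  assumes "k \<noteq> card {j. j < length xs \<and> j \<in> I}"
  shows "zero_pad n (nths (xs @ [a]) I) ! k = zero_pad n (nths (xs @ [b]) I) ! k"
  using assms
  by (simp add: zero_pad_def nths_append nth_append length_nths nth_Cons split: nat.split)

text \<open>Both traces are coupled through the same deletion pattern \<open>d\<close>. The query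
  values can differ only if the last bit would land in the window read by \<open>q\<close>, and then
  by at most 2, the width of [-1,1].\<close>

lemma local_query_last_bit:
  assumes "0 < \<delta>" "\<delta> < 1" and q: "local_query (Suc m) l q" and m: "length xs = m"
  shows "\<bar>measure_pmf.expectation (trace_pmf \<delta> (xs @ [a])) q
           - measure_pmf.expectation (trace_pmf \<delta> (xs @ [b])) q\<bar>
         \<le> 2 * (real l / sqrt (real (Suc m) * \<delta> * (1 - \<delta>)))"
proof -
  obtain i q' where i: "i + l \<le> Suc m"
    and q': "\<And>z. length z = l \<Longrightarrow> q' z \<in> {-1..1}"
    and qq': "\<And>y. length y = Suc m \<Longrightarrow> q y = q' (take l (drop i y))"
    using q unfolding local_query_def by blast
  let ?P = "Pi_pmf {..<Suc m} False (\<lambda>_. bernoulli_pmf \<delta>)"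
  let ?W = "{d. card {j. j < m \<and> \<not> d j} \<in> {i..<i + l}}"
  define y where "y c d = zero_pad (Suc m) (nths (xs @ [c]) {j. \<not> d j})" for c d
  have len: "length (y c d) = Suc m" for c d
    using length_zero_pad_nths[of "xs @ [c]"] m by (simp add: y_def)
  have fin: "finite (set_pmf ?P)"
    by (rule finite_subset[OF set_Pi_pmf_subset']) (auto intro!: finite_PiE_dflt)
  have int: "integrable ?P f" for f :: "_ \<Rightarrow> real"
    by (rule integrable_measure_pmf_finite[OF fin])
  have pw: "\<bar>q (y a d) - q (y b d)\<bar> \<le> 2 * indicator ?W d" for d
  proof (cases "d \<in> ?W")
    case True
    have "q (y c d) \<in> {-1..1}" for c
      using qq'[OF len] q' len i by simp
    from this[of a] this[of b] True show ?thesis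
      by (simp add: abs_le_iff)
  next
    case False
    have "take l (drop i (y a d)) = take l (drop i (y b d))"
    proof (rule nth_equalityI)
      fix k assume "k < length (take l (drop i (y a d)))"
      then have "k < l" using len by simp
      with False have "i + k \<noteq> card {j. j < length xs \<and> j \<in> {j. \<not> d j}}"
        using m by auto
      with \<open>k < l\<close> show "take l (drop i (y a d)) ! k = take l (drop i (y b d)) ! k"
        using len i unfolding y_def by (simp add: zero_pad_nths_snoc_nth)
    qed (simp add: len)
    then show ?thesis
      by (simp add: qq'[OF len])
  qed
  have "\<bar>measure_pmf.expectation (trace_pmf \<delta> (xs @ [a])) q
           - measure_pmf.expectation (trace_pmf \<delta> (xs @ [b])) q\<bar>
        = \<bar>measure_pmf.expectation ?P (\<lambda>d. q (y a d) - q (y b d))\<bar>"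
    by (simp add: expectation_trace_pmf m y_def Bochner_Integration.integral_diff[OF int int])
  also have "\<dots> \<le> measure_pmf.expectation ?P (\<lambda>d. \<bar>q (y a d) - q (y b d)\<bar>)"
    by (rule integral_abs_bound)
  also have "\<dots> \<le> measure_pmf.expectation ?P (\<lambda>d. 2 * indicator ?W d)"
    by (intro integral_mono int pw)
  also have "\<dots> = 2 * measure_pmf.prob ?P ?W"
    by simp
  finally show ?thesis
    using prob_surviving_count_window[OF assms(1,2), of m i l] by linarith
qed

section \<open>Indistinguishable sources\<close>

lemma halts_with_unique:
  assumes "halts_with A r z" "halts_with A r w"
  shows "z = w"
proof -
  obtain m where m: "A (map r [0..<m]) = Output z" "\<forall>j<m. \<forall>w. A (map r [0..<j]) \<noteq> Output w"
    using assms(1) unfolding halts_with_def by blast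
  obtain k where k: "A (map r [0..<k]) = Output w" "\<forall>j<k. \<forall>w. A (map r [0..<j]) \<noteq> Output w"
    using assms(2) unfolding halts_with_def by blast
  have "m = k"
    using m k by (metis linorder_neqE_nat)
  with m k show ?thesis by simp
qed

text \<open>An adaptive query depends on the earlier responses, so \<open>r\<close> is built by
  recursion on the history: \<open>H m\<close> holds the first \<open>m\<close> answers.\<close>

lemma exists_exact_responses:
  fixes A :: sq_algorithm and v :: "(bool list \<Rightarrow> real) \<Rightarrow> real"
  shows "\<exists>r. \<forall>m q \<tau>. A (map r [0..<m]) = Query q \<tau> \<longrightarrow> r m = v q"
proof -
  define ans where "ans h = (case A h of Query q \<tau> \<Rightarrow> v q | Output z \<Rightarrow> 0)" for h
  define H where "H = rec_nat [] (\<lambda>_ h. h @ [ans h])"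
  define r where "r m = ans (H m)" for m
  have "map r [0..<m] = H m" for m
    by (induction m) (simp_all add: H_def r_def)
  then have "\<forall>m q \<tau>. A (map r [0..<m]) = Query q \<tau> \<longrightarrow> r m = v q"
    by (simp add: r_def ans_def)
  then show ?thesis by blast
qed

text \<open>The exact expectations for \<open>x\<close> are valid responses for both sources, yet a
  single run has a single output.\<close>

lemma reconstructs_indistinguishable:
  assumes A: "local_sq_algorithm n l \<tau>\<^sub>0 A"
    and close: "\<And>q. local_query n l q \<Longrightarrow>
      \<bar>measure_pmf.expectation (trace_pmf \<delta> x) q - measure_pmf.expectation (trace_pmf \<delta> x') q\<bar> \<le> \<tau>\<^sub>0"
    and "reconstructs \<delta> A x" "reconstructs \<delta> A x'"
  shows "x = x'"
proof -
  obtain r where r: "\<And>m q \<tau>. A (map r [0..<m]) = Query q \<tau> \<Longrightarrow>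
      r m = measure_pmf.expectation (trace_pmf \<delta> x) q"
    using exists_exact_responses[of A "measure_pmf.expectation (trace_pmf \<delta> x)"] by blast
  have "valid_responses \<delta> x A r"
    using A r unfolding valid_responses_def local_sq_algorithm_def
    by (metis abs_zero diff_self less_imp_le)
  moreover have "valid_responses \<delta> x' A r"
    using A r close unfolding valid_responses_def local_sq_algorithm_def
    by (metis order_trans)
  ultimately show ?thesis
    using assms(3,4) halts_with_unique unfolding reconstructs_def by blast
qed

text \<open>Choosing one suitable last bit for each prefix injects the prefixes into
  \<open>B\<close>.\<close>

lemma card_snoc_meets_ge:
  assumes "\<And>xs :: bool list. length xs = m \<Longrightarrow> \<exists>b. xs @ [b] \<in> B" and "finite B"
  shows "2 ^ m \<le> card B"
proof -
  obtain f where f: "\<And>xs :: bool list. length xs = m \<Longrightarrow> xs @ [f xs] \<in> B"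
    using assms(1) by metis
  have "card {xs :: bool list. length xs = m} = card ((\<lambda>xs. xs @ [f xs]) ` {xs. length xs = m})"
    by (intro card_image[symmetric] inj_onI) auto
  also have "\<dots> \<le> card B"
    using f assms(2) by (intro card_mono) auto
  finally show ?thesis
    using card_lists_length_eq[of "UNIV :: bool set" m] by simp
qed

theorem theorem5p1:
  fixes \<delta> :: real
  assumes "0 < \<delta>" and "\<delta> < 1"
  shows "\<exists>C>0. \<forall>(l :: nat \<Rightarrow> nat) (\<tau>\<^sub>0 :: nat \<Rightarrow> real) (A :: nat \<Rightarrow> sq_algorithm).
           (\<forall>n. local_sq_algorithm n (l n) (\<tau>\<^sub>0 n) (A n)) \<longrightarrow>
           solves_average_case \<delta> A \<longrightarrow>
           (\<forall>\<^sub>F n in sequentially. \<tau>\<^sub>0 n \<le> C * real (l n) / sqrt (real n))"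
proof -
  \<comment> \<open>The bound of \<open>local_query_last_bit\<close> with \<open>l / sqrt n\<close>
    factored out.\<close>
  define C where "C = 2 / sqrt (\<delta> * (1 - \<delta>))"
  have "C > 0"
    using assms by (simp add: C_def)
  moreover have "\<forall>\<^sub>F n in sequentially. \<tau>\<^sub>0 n \<le> C * real (l n) / sqrt (real n)"
    if alg: "\<forall>n. local_sq_algorithm n (l n) (\<tau>\<^sub>0 n) (A n)" and sol: "solves_average_case \<delta> A"
    for l :: "nat \<Rightarrow> nat" and \<tau>\<^sub>0 :: "nat \<Rightarrow> real" and A :: "nat \<Rightarrow> sq_algorithm"
  proof -
    define B where "B n = {x. length x = n \<and> \<not> reconstructs \<delta> (A n) x}" for n
    have fin: "finite (B n)" for n
      by (rule finite_subset[OF _ finite_lists_length_eq[of "UNIV :: bool set" n]])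
        (auto simp: B_def)
    have "\<forall>\<^sub>F n in sequentially. real (card (B n)) / 2 ^ n < 1 / 2"
      using sol unfolding solves_average_case_def B_def by (rule order_tendstoD) simp
    \<comment> \<open>Positive \<open>n\<close> ensures that there is a last bit to flip.\<close>
    with eventually_gt_at_top[of 0] show ?thesis
    proof eventually_elim
      case (elim n)
      then obtain m where n: "n = Suc m"
        using gr0_implies_Suc by blast
      show ?case
      proof (rule ccontr)
        assume "\<not> ?thesis"
        moreover have "C * real (l n) / sqrt (real n)
            = 2 * (real (l n) / sqrt (real (Suc m) * \<delta> * (1 - \<delta>)))"
          by (simp add: C_def n real_sqrt_mult mult_ac)
        ultimately have large: "2 * (real (l n) / sqrt (real (Suc m) * \<delta> * (1 - \<delta>))) \<le> \<tau>\<^sub>0 n"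
          by linarith
        have "\<exists>b. xs @ [b] \<in> B n" if xs: "length xs = m" for xs
        proof (rule ccontr)
          assume "\<not> ?thesis"
          then have "reconstructs \<delta> (A n) (xs @ [b])" for b
            using xs n by (auto simp: B_def)
          moreover have "\<bar>measure_pmf.expectation (trace_pmf \<delta> (xs @ [True])) q
              - measure_pmf.expectation (trace_pmf \<delta> (xs @ [False])) q\<bar> \<le> \<tau>\<^sub>0 n"
            if "local_query n (l n) q" for q
            using local_query_last_bit[OF assms _ xs] that large n by (meson order_trans)
          ultimately have "xs @ [True] = xs @ [False]"
            using reconstructs_indistinguishable alg by blast
          then show False by simp
        qed
        then have "2 ^ m \<le> card (B n)"
          using fin by (rule card_snoc_meets_ge)
        \<comment> \<open>As \<open>n = Suc m\<close>, this is half of all sources, against the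
          strict bound 1/2 from \<open>sol\<close>.\<close>
        then have "(2 :: real) ^ m \<le> real (card (B n))"
          by (metis of_nat_le_iff of_nat_numeral of_nat_power)
        with elim n show False
          by (simp add: field_simps)
      qed
    qed
  qed
  ultimately show ?thesis by blast
qed

end
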